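(* A function $\varphi:\mathbb{Z}\to\mathbb{C}$ is reflection positive for $(\mathbb{Z},\mathbb{N}_0,-\mathrm{id}_{\mathbb{Z}})$ if and only if there exists a finite positive Borel measure $\mu$ on $[-1,1]$ with $$\varphi(n)=\int_{-1}^1\lambda^{|n|}\,d\mu(\lambda)\quad\text{ for all } n\in\mathbb{Z}.$$
   Context: A function $\varphi:\mathbb{Z}\to\mathbb{C}$ is called reflection positive for $(\mathbb{Z},\mathbb{N}_0,-\mathrm{id}_{\mathbb{Z}})$ if it is positive definite, i.e. the kernel $(\varphi(n-m))_{n,m\in\mathbb{Z}}$ is positive definite, and the kernel $(\varphi(n+m))_{n,m\ge 0}$ is also positive definite. The convention $0^0=1$ is used. *)

theory Defs
  imports "HOL-Analysis.Analysis"
begin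

text \<open>
  Positive definiteness of a complex kernel on \<open>X\<close>: every Hermitian form
  \<open>\<Sum> K x y * cnj (c x) * c y\<close> over a finite subset of \<open>X\<close> takes values in the
  nonnegative reals. Membership in \<open>\<real>\<^sub>\<ge>\<^sub>0\<close> includes that the sum is real.
\<close>

definition pos_def_kernel_on :: "'a set \<Rightarrow> ('a \<Rightarrow> 'a \<Rightarrow> complex) \<Rightarrow> bool" where
  "pos_def_kernel_on X K \<longleftrightarrow>
     (\<forall>F c. finite F \<longrightarrow> F \<subseteq> X \<longrightarrow>
        (\<Sum>x\<in>F. \<Sum>y\<in>F. K x y * cnj (c x) * c y) \<in> \<real>\<^sub>\<ge>\<^sub>0)"

definition pos_def_fun :: "(int \<Rightarrow> complex) \<Rightarrow> bool" where
  "pos_def_fun \<phi> \<longleftrightarrow> pos_def_kernel_on UNIV (\<lambda>n m. \<phi> (n - m))"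

text \<open>
  Reflection positivity for the triple of the group \<open>\<int>\<close>, the subsemigroup of nonnegative
  integers, and the involution \<open>n \<mapsto> - n\<close>, which turns the kernel \<open>\<phi> (n - m)\<close> into
  \<open>\<phi> (n + m)\<close>.
\<close>

definition reflection_positive_int :: "(int \<Rightarrow> complex) \<Rightarrow> bool" where
  "reflection_positive_int \<phi> \<longleftrightarrow>
     pos_def_fun \<phi> \<and> pos_def_kernel_on {0..} (\<lambda>n m. \<phi> (n + m))"

end

theory Submission
  imports Defs "HOL-Probability.Probability"
begin

text \<open>
  Both kernels of a moment function are mixtures, over \<open>r\<close> in \<open>[-1, 1]\<close>, of the kernels of
  \<open>n \<mapsto> r ^ \<bar>n\<bar>\<close>, and those are Gram kernels. For \<open>r ^ (n + m)\<close> on the nonnegative integers this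
  is clear. For \<open>r ^ \<bar>n - m\<bar>\<close> one telescopes: for \<open>i, j \<ge> 0\<close>,
  \<open>r ^ \<bar>i - j\<bar> = r ^ i * r ^ j + (1 - r\<^sup>2) * (\<Sum>k = 1..min i j. r ^ (i - k) * r ^ (j - k))\<close>,
  and \<open>1 - r\<^sup>2 \<ge> 0\<close>. Integration preserves positive definiteness.
  
  Conversely, let \<open>\<phi>\<close> be reflection positive. Hermitian symmetry of the two kernels makes \<open>\<phi>\<close>
  real and even, and the restriction of the first kernel to two points gives \<open>\<bar>\<phi> n\<bar> \<le> \<phi> 0\<close>. What remains is a
  moment problem: the bounded sequence \<open>a n = \<phi> n\<close> has a positive semidefinite Hankel form. Let \<open>L\<close>
  be the linear functional on polynomials with \<open>L (x ^ n) = a n\<close>, so that \<open>L\<close> is nonnegative on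
  squares. Boundedness improves this to \<open>L ((1 - x\<^sup>2) * q\<^sup>2) \<ge> 0\<close>: the sequence
  \<open>k \<mapsto> L (x ^ (2 * k) * q\<^sup>2)\<close> is convex, because its second differences are values of \<open>L\<close> on
  squares, and a bounded convex sequence is decreasing
  (\<open>one_minus_square_nonneg\<close>). It follows that \<open>L\<close> is nonnegative on all products
  \<open>(1 + x) ^ k * (1 - x) ^ i\<close>.
  
  After moving \<open>[-1, 1]\<close> to \<open>[0, 1]\<close> this says that \<open>L\<close> is nonnegative on Bernstein polynomials.
  The values of \<open>L\<close> on the Bernstein polynomials of degree \<open>N\<close> are then the weights of a positive
  measure of mass \<open>L 1\<close> on the points \<open>k / N\<close>, whose factorial moments are exactly those that the solution must
  have and whose ordinary moments differ from them by \<open>O(1 / N)\<close>. Helly's selection theorem yields a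
  weak limit, which is the representing measure (\<open>unit_interval_moment_problem\<close>).
\<close>

section \<open>Positive definite kernels\<close>

text \<open>
  The definition only says that the quadratic form is real and nonnegative; Hermitian symmetry follows
  by polarization, testing two points with the coefficient vectors \<open>(1, 1)\<close> and \<open>(1, \<i>)\<close>.
\<close>

lemma pos_def_kernel_on_hermitian:
  assumes K: "pos_def_kernel_on X K" and x: "x \<in> X" and y: "y \<in> X"
  shows "K y x = cnj (K x y)"
proof -
  have diag: "K z z \<in> \<real>\<^sub>\<ge>\<^sub>0" if "z \<in> X" for z
    using K[unfolded pos_def_kernel_on_def, rule_format, of "{z}" "\<lambda>_. 1"] that by simp
  show ?thesis
  proof (cases "x = y")
    case True
    then show ?thesis
      using diag[OF x] by (simp add: complex_eq_iff complex_nonneg_Reals_iff)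
  next
    case False
    have "K x x + K x y + (K y x + K y y) \<in> \<real>\<^sub>\<ge>\<^sub>0"
      using K[unfolded pos_def_kernel_on_def, rule_format, of "{x, y}" "\<lambda>_. 1"] x y False by simp
    moreover have "K x x + K x y * \<i> + (K y x * cnj \<i> + K y y) \<in> \<real>\<^sub>\<ge>\<^sub>0"
      using K[unfolded pos_def_kernel_on_def, rule_format, of "{x, y}" "\<lambda>z. if z = x then 1 else \<i>"]
        x y False by (simp add: mult.assoc)
    ultimately show ?thesis
      using diag[OF x] diag[OF y] by (simp add: complex_eq_iff complex_nonneg_Reals_iff)
  qed
qed

text \<open>
  A Gram kernel gives a sum of squared moduli. The feature vectors \<open>e F\<close> may change with the finite
  set \<open>F\<close> of points, since each instance of positive definiteness only sees one such set. This makes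
  it possible to choose an origin to the left of all points of \<open>F\<close> in the two-sided infinite group of
  integers.
\<close>

lemma pos_def_kernel_on_gram:
  fixes e :: "'a set \<Rightarrow> 'b \<Rightarrow> 'a \<Rightarrow> real"
  assumes S: "\<And>F. finite (S F)"
    and K: "\<And>F x y. finite F \<Longrightarrow> F \<subseteq> X \<Longrightarrow> x \<in> F \<Longrightarrow> y \<in> F \<Longrightarrow>
              K x y = complex_of_real (\<Sum>k\<in>S F. e F k x * e F k y)"
  shows "pos_def_kernel_on X K"
  unfolding pos_def_kernel_on_def
proof (intro allI impI)
  fix F and c :: "'a \<Rightarrow> complex"
  assume F: "finite F" "F \<subseteq> X"
  define z where "z k = (\<Sum>y\<in>F. complex_of_real (e F k y) * c y)" for k
  have "(\<Sum>x\<in>F. \<Sum>y\<in>F. K x y * cnj (c x) * c y)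
      = (\<Sum>x\<in>F. \<Sum>y\<in>F. \<Sum>k\<in>S F.
          (complex_of_real (e F k x) * cnj (c x)) * (complex_of_real (e F k y) * c y))"
    by (intro sum.cong refl) (simp add: K[OF F] sum_distrib_left sum_distrib_right mult_ac)
  also have "\<dots> = (\<Sum>x\<in>F. \<Sum>k\<in>S F. \<Sum>y\<in>F.
          (complex_of_real (e F k x) * cnj (c x)) * (complex_of_real (e F k y) * c y))"
    by (intro sum.cong refl sum.swap)
  also have "\<dots> = (\<Sum>k\<in>S F. \<Sum>x\<in>F. \<Sum>y\<in>F.
          (complex_of_real (e F k x) * cnj (c x)) * (complex_of_real (e F k y) * c y))"
    by (rule sum.swap)
  also have "\<dots> = (\<Sum>k\<in>S F. cnj (z k) * z k)"
    by (simp add: z_def sum_product)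
  also have "\<dots> = complex_of_real (\<Sum>k\<in>S F. (cmod (z k))\<^sup>2)"
    by (simp add: complex_norm_square mult.commute del: of_real_power)
  also have "\<dots> \<in> \<real>\<^sub>\<ge>\<^sub>0"
    unfolding nonneg_Reals_of_real_iff by (intro sum_nonneg) simp
  finally show "(\<Sum>x\<in>F. \<Sum>y\<in>F. K x y * cnj (c x) * c y) \<in> \<real>\<^sub>\<ge>\<^sub>0" .
qed

lemma pos_def_kernel_on_integral:
  fixes K :: "'b \<Rightarrow> 'a \<Rightarrow> 'a \<Rightarrow> complex"
  assumes K: "\<And>t. t \<in> space M \<Longrightarrow> pos_def_kernel_on X (K t)"
    and int: "\<And>x y. x \<in> X \<Longrightarrow> y \<in> X \<Longrightarrow> integrable M (\<lambda>t. K t x y)"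
  shows "pos_def_kernel_on X (\<lambda>x y. \<integral>t. K t x y \<partial>M)"
  unfolding pos_def_kernel_on_def
proof (intro allI impI)
  fix F and c :: "'a \<Rightarrow> complex"
  assume F: "finite F" "F \<subseteq> X"
  define q where "q t = (\<Sum>x\<in>F. \<Sum>y\<in>F. K t x y * cnj (c x) * c y)" for t
  have q: "q t \<in> \<real>\<^sub>\<ge>\<^sub>0" if "t \<in> space M" for t
    using K[OF that] F unfolding pos_def_kernel_on_def q_def by blast
  have "(\<Sum>x\<in>F. \<Sum>y\<in>F. (\<integral>t. K t x y \<partial>M) * cnj (c x) * c y) = (\<integral>t. q t \<partial>M)"
  proof -
    have "integrable M (\<lambda>t. K t x y * cnj (c x) * c y)" if "x \<in> F" "y \<in> F" for x y
      using that F(2) by (intro integrable_mult_left int) auto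
    then show ?thesis
      by (simp add: q_def)
  qed
  also have "\<dots> = (\<integral>t. complex_of_real (Re (q t)) \<partial>M)"
    by (intro Bochner_Integration.integral_cong refl)
       (use q in \<open>auto simp: complex_eq_iff complex_nonneg_Reals_iff\<close>)
  also have "\<dots> = complex_of_real (\<integral>t. Re (q t) \<partial>M)"
    by simp
  also have "\<dots> \<in> \<real>\<^sub>\<ge>\<^sub>0"
    unfolding nonneg_Reals_of_real_iff
    by (rule Bochner_Integration.integral_nonneg) (use q in \<open>auto simp: complex_nonneg_Reals_iff\<close>)
  finally show "(\<Sum>x\<in>F. \<Sum>y\<in>F. (\<integral>t. K t x y \<partial>M) * cnj (c x) * c y) \<in> \<real>\<^sub>\<ge>\<^sub>0" .
qed


section \<open>Moment sequences are reflection positive\<close>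

text \<open>
  For \<open>i \<le> j\<close> the sum on the right is geometric, and multiplication by \<open>1 - r\<^sup>2\<close> telescopes it to
  \<open>r ^ (j - i) - r ^ (i + j)\<close>. The index range is cut out of the fixed interval \<open>{1..N}\<close> so that the
  same range serves all pairs of points of a finite set.
\<close>

lemma power_dist_eq_gram_sum:
  fixes r :: real and i j N :: nat
  assumes "i \<le> N" "j \<le> N"
  shows "r ^ nat \<bar>int i - int j\<bar>
    = r ^ i * r ^ j + (1 - r\<^sup>2) * (\<Sum>k | k \<in> {1..N} \<and> k \<le> i \<and> k \<le> j. r ^ (i - k) * r ^ (j - k))"
  using assms
proof (induction i j rule: linorder_wlog)
  case (le i j)
  have "r ^ (j - i) = r ^ i * r ^ j + (1 - r\<^sup>2) * (\<Sum>k=1..i. r ^ (i - k) * r ^ (j - k))"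
    using \<open>i \<le> j\<close>
  proof (induction i arbitrary: j)
    case 0
    then show ?case by simp
  next
    case (Suc i)
    then obtain j' where j: "j = Suc j'" "i \<le> j'"
      by (cases j) auto
    have "(\<Sum>k=1..Suc i. r ^ (Suc i - k) * r ^ (j - k))
        = r ^ i * r ^ j' + (\<Sum>k=1..i. r ^ (i - k) * r ^ (j' - k))"
    proof -
      have "(\<Sum>k=1..Suc i. r ^ (Suc i - k) * r ^ (j - k))
          = r ^ i * r ^ j' + (\<Sum>k=Suc 1..Suc i. r ^ (Suc i - k) * r ^ (j - k))"
        by (subst sum.atLeast_Suc_atMost) (simp_all add: j)
      then show ?thesis
        unfolding sum.shift_bounds_cl_Suc_ivl by (simp add: j)
    qed
    with Suc.IH[OF j(2)] show ?case
      by (simp add: j algebra_simps power2_eq_square)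
  qed
  moreover have "{k. k \<in> {1..N} \<and> k \<le> i \<and> k \<le> j} = {1..i}"
    using le by auto
  moreover have "nat \<bar>int i - int j\<bar> = j - i"
    using le(1) by simp
  ultimately show ?case by (simp only:)
next
  case (sym i j)
  have "nat \<bar>int i - int j\<bar> = nat \<bar>int j - int i\<bar>"
    by simp
  moreover have "{k. k \<in> {1..N} \<and> k \<le> i \<and> k \<le> j} = {k. k \<in> {1..N} \<and> k \<le> j \<and> k \<le> i}"
    by auto
  ultimately show ?case
    using sym by (simp add: mult.commute)
qed

text \<open>
  The kernel depends only on differences, so the points of a finite set may be counted from its
  minimum. They are then naturals, and the preceding identity exhibits a feature vector for the
  point \<open>i\<close>: its entries are \<open>r ^ i\<close> and, for \<open>1 \<le> k \<le> i\<close>, \<open>sqrt (1 - r\<^sup>2) * r ^ (i - k)\<close>.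
\<close>

lemma pos_def_kernel_power_dist:
  fixes r :: real
  assumes r: "\<bar>r\<bar> \<le> 1"
  shows "pos_def_kernel_on UNIV (\<lambda>n m. complex_of_real (r ^ nat \<bar>n - m\<bar>))"
proof -
  define pos where "pos F n = nat (n - Min F)" for F :: "int set" and n
  define N where "N F = Max (pos F ` F)" for F
  define e where "e F k n = (if k = 0 then r ^ pos F n
      else if k \<le> pos F n then sqrt (1 - r\<^sup>2) * r ^ (pos F n - k) else 0)" for F k n
  show ?thesis
  proof (rule pos_def_kernel_on_gram[where S = "\<lambda>F. {0..N F}" and e = e])
    fix F :: "int set" and n m
    assume F: "finite F" and nm: "n \<in> F" "m \<in> F"
    have le: "pos F n \<le> N F" "pos F m \<le> N F"
      using F nm by (auto simp: N_def)
    have "int (pos F n) - int (pos F m) = n - m"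
      using F nm by (simp add: pos_def)
    then have "r ^ nat \<bar>n - m\<bar> = r ^ pos F n * r ^ pos F m + (1 - r\<^sup>2) *
        (\<Sum>k | k \<in> {1..N F} \<and> k \<le> pos F n \<and> k \<le> pos F m. r ^ (pos F n - k) * r ^ (pos F m - k))"
      using power_dist_eq_gram_sum[OF le, of r] by simp
    also have "\<dots> = e F 0 n * e F 0 m +
        (\<Sum>k | k \<in> {1..N F} \<and> k \<le> pos F n \<and> k \<le> pos F m. e F k n * e F k m)"
    proof -
      have "sqrt (1 - r\<^sup>2) * sqrt (1 - r\<^sup>2) = 1 - r\<^sup>2"
        using r by (simp add: abs_square_le_1)
      then have "e F k n * e F k m = (1 - r\<^sup>2) * (r ^ (pos F n - k) * r ^ (pos F m - k))"
        if "k \<in> {1..N F}" "k \<le> pos F n" "k \<le> pos F m" for k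
        using that by (simp add: e_def mult_ac)
      then show ?thesis
        by (simp add: sum_distrib_left) (simp add: e_def)
    qed
    also have "(\<Sum>k | k \<in> {1..N F} \<and> k \<le> pos F n \<and> k \<le> pos F m. e F k n * e F k m)
        = (\<Sum>k\<in>{1..N F}. e F k n * e F k m)"
      by (intro sum.mono_neutral_left) (auto simp: e_def)
    also have "e F 0 n * e F 0 m + \<dots> = (\<Sum>k\<in>{0..N F}. e F k n * e F k m)"
      by (simp add: sum.atLeast_Suc_atMost)
    finally show "complex_of_real (r ^ nat \<bar>n - m\<bar>)
        = complex_of_real (\<Sum>k\<in>{0..N F}. e F k n * e F k m)"
      by simp
  qed auto
qed

lemma reflection_positive_int_moments:
  fixes \<mu> :: "real measure"
  assumes "finite_measure \<mu>" and \<mu>: "sets \<mu> = sets (restrict_space borel {-1..1})"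
  shows "reflection_positive_int (\<lambda>n. \<integral>x. complex_of_real (x ^ nat \<bar>n\<bar>) \<partial>\<mu>)"
proof -
  interpret finite_measure \<mu> by fact
  have space: "space \<mu> = {-1..1}"
    using sets_eq_imp_space_eq[OF \<mu>] by (simp add: space_restrict_space)
  have "(\<lambda>x. complex_of_real (x ^ k)) \<in> borel_measurable (restrict_space borel {-1..1})" for k
    by (intro measurable_restrict_space1) simp
  then have meas: "(\<lambda>x. complex_of_real (x ^ k)) \<in> borel_measurable \<mu>" for k
    using measurable_cong_sets[OF \<mu> refl] by blast
  have int: "integrable \<mu> (\<lambda>x. complex_of_real (x ^ k))" for k
    by (rule integrable_const_bound[where B = 1])
       (use meas[of k] in \<open>auto simp: space norm_power intro!: power_le_one AE_I2\<close>)
  have "pos_def_kernel_on UNIV (\<lambda>n m. \<integral>x. complex_of_real (x ^ nat \<bar>n - m\<bar>) \<partial>\<mu>)"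
    by (intro pos_def_kernel_on_integral pos_def_kernel_power_dist int) (auto simp: space)
  moreover have "pos_def_kernel_on {0..} (\<lambda>n m. \<integral>x. complex_of_real (x ^ nat \<bar>n + m\<bar>) \<partial>\<mu>)"
  proof (intro pos_def_kernel_on_integral int)
    fix x :: real
    show "pos_def_kernel_on {0..} (\<lambda>n m. complex_of_real (x ^ nat \<bar>n + m\<bar>))"
      by (rule pos_def_kernel_on_gram[where S = "\<lambda>_. {()}" and e = "\<lambda>_ _ n. x ^ nat n"])
         (auto simp: nat_add_distrib power_add subset_iff)
  qed
  ultimately show ?thesis
    by (simp add: reflection_positive_int_def pos_def_fun_def)
qed


section \<open>Linear functionals on real polynomials\<close>

text \<open>
  The indeterminate is kept as an opaque constant: with \<open>[:0, 1:]\<close> in its place, the simplifier would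
  multiply out coefficient lists instead of treating polynomial identities as ring identities.
\<close>

definition indet :: "real poly" where
  "indet = [:0, 1:]"

lemma poly_indet [simp]: "poly indet x = x"
  by (simp add: indet_def)

lemma poly_eq_sum_indet: "p = (\<Sum>i\<le>degree p. smult (coeff p i) (indet ^ i))"
  using poly_as_sum_of_monoms[of p] by (simp add: indet_def monom_altdef)

lemma pcompose_indet_power [simp]: "pcompose (indet ^ n) p = p ^ n"
  by (induction n) (simp_all add: pcompose_1 pcompose_mult indet_def pcompose_pCons)

lemma pcompose_one_minus_indet_power [simp]: "pcompose ((1 - indet) ^ n) p = (1 - p) ^ n"
  by (induction n) (simp_all add: pcompose_1 pcompose_mult pcompose_diff indet_def pcompose_pCons)

locale poly_functional =
  fixes L :: "real poly \<Rightarrow> real"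
  assumes add: "L (p + q) = L p + L q"
    and smult: "L (smult c p) = c * L p"
begin

lemma zero [simp]: "L 0 = 0"
  using smult[of 0 0] by simp

lemma diff: "L (p - q) = L p - L q"
  using add[of p "smult (-1) q"] smult[of "-1" q] by simp

lemma sum: "L (\<Sum>i\<in>A. f i) = (\<Sum>i\<in>A. L (f i))"
  by (induction A rule: infinite_finite_induct) (simp_all add: add)

lemma expand: "L p = (\<Sum>i\<le>degree p. coeff p i * L (indet ^ i))"
  by (subst (1) poly_eq_sum_indet) (simp add: sum smult)

lemma expand_mult: "L (q * p) = (\<Sum>i\<le>degree p. coeff p i * L (q * indet ^ i))"
  by (subst (1) poly_eq_sum_indet) (simp add: sum smult sum_distrib_left)

end


section \<open>The moment problem on the unit interval\<close>

definition bernstein_poly :: "nat \<Rightarrow> nat \<Rightarrow> real poly" where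
  "bernstein_poly N k = smult (real (N choose k)) (indet ^ k * (1 - indet) ^ (N - k))"

text \<open>
  This is the falling factorial moment of a binomial distribution. The product of binomial
  coefficients turns into \<open>(N choose m) * ((N - m) choose (k - m))\<close>, after which the factor \<open>indet ^ m\<close>
  splits off and the binomial theorem for \<open>indet + (1 - indet)\<close> collapses the rest. The case \<open>m = 0\<close>
  is the partition of unity.
\<close>

lemma bernstein_factorial_moment:
  assumes "m \<le> N"
  shows "(\<Sum>k\<le>N. smult (real (k choose m) / real (N choose m)) (bernstein_poly N k)) = indet ^ m"
proof -
  have coeff: "real (k choose m) / real (N choose m) * real (N choose k) = real ((N - m) choose (k - m))"
    if "m \<le> k" "k \<le> N" for k
  proof -
    have "real (N choose k) * real (k choose m) = real (N choose m) * real ((N - m) choose (k - m))"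
      using choose_mult[OF that] by (metis of_nat_mult)
    then show ?thesis
      using assms by (simp add: field_simps)
  qed
  have "(\<Sum>k\<le>N. smult (real (k choose m) / real (N choose m)) (bernstein_poly N k))
      = (\<Sum>k\<in>{m..N}. smult (real (k choose m) / real (N choose m)) (bernstein_poly N k))"
    by (intro sum.mono_neutral_right) (auto simp: not_le)
  also have "\<dots> = (\<Sum>k\<in>{m..N}. smult (real ((N - m) choose (k - m))) (indet ^ k * (1 - indet) ^ (N - k)))"
    by (intro sum.cong refl) (simp add: bernstein_poly_def coeff del: times_divide_eq_left)
  also have "\<dots> = (\<Sum>l\<le>N - m. smult (real ((N - m) choose l)) (indet ^ (m + l) * (1 - indet) ^ (N - m - l)))"
    using assms by (intro sum.reindex_bij_witness[of _ "\<lambda>l. m + l" "\<lambda>k. k - m"]) auto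
  also have "\<dots> = indet ^ m * (\<Sum>l\<le>N - m. of_nat ((N - m) choose l) * indet ^ l * (1 - indet) ^ (N - m - l))"
    by (simp add: sum_distrib_left power_add mult_ac of_nat_poly)
  also have "\<dots> = indet ^ m"
    by (subst binomial_ring[symmetric]) simp
  finally show ?thesis .
qed

lemma binomial_ratio_eq_prod:
  assumes "m \<le> N"
  shows "real (k choose m) / real (N choose m) = (\<Prod>i<m. real (k - i) / real (N - i))"
  using assms
proof (induction m)
  case 0
  then show ?case by simp
next
  case (Suc m)
  have step: "real (Suc m) * real (n choose Suc m) = real (n - m) * real (n choose m)" for n
    using binomial_absorption[of m n] binomial_absorb_comp[of n m] by (metis of_nat_mult)
  have "real (k choose Suc m) / real (N choose Suc m)
      = (real (Suc m) * real (k choose Suc m)) / (real (Suc m) * real (N choose Suc m))"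
    by (rule mult_divide_mult_cancel_left[symmetric]) simp
  also have "\<dots> = real (k choose m) / real (N choose m) * (real (k - m) / real (N - m))"
    by (simp only: step times_divide_times_eq) (simp add: mult.commute)
  finally show ?case
    using Suc by simp
qed

text \<open>
  Both terms are products of \<open>m\<close> factors in \<open>[0, 1]\<close>, so they differ by at most the sum of the
  differences of the factors \<open>(k - i) / (N - i)\<close> and \<open>k / N\<close>, each of which is at most \<open>i / N\<close>.
  Subtraction truncates, which keeps the factors with \<open>k < i\<close> nonnegative.
\<close>

lemma binomial_ratio_power_bound:
  assumes "m \<le> N" "k \<le> N" "0 < N"
  shows "\<bar>real (k choose m) / real (N choose m) - (real k / real N) ^ m\<bar> \<le> real m * real m / real N"
proof -
  have factor: "\<bar>real (k - i) / real (N - i) - real k / real N\<bar> \<le> real m / real N" if "i < m" for i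
  proof (cases "i \<le> k")
    case True
    have "real k / real N - real (k - i) / real (N - i) = (real i / real N) * (real (N - k) / real (N - i))"
      using True that assms by (simp add: of_nat_diff field_simps)
    moreover have "0 \<le> real (N - k) / real (N - i)" "real (N - k) / real (N - i) \<le> 1"
      using True that assms by simp_all
    moreover have "0 \<le> real i / real N" "real i / real N \<le> real m / real N"
      using that by (simp_all add: divide_right_mono)
    ultimately show ?thesis
      by (smt (verit, best) mult_left_le mult_nonneg_nonneg)
  next
    case False
    then show ?thesis
      using that by (simp add: divide_right_mono)
  qed
  have "norm ((\<Prod>i<m. real (k - i) / real (N - i)) - (\<Prod>i<m. real k / real N))
      \<le> (\<Sum>i<m. norm (real (k - i) / real (N - i) - real k / real N))"
    using assms by (intro norm_prod_diff) (auto simp: divide_le_eq_1)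
  also have "\<dots> \<le> (\<Sum>i<m. real m / real N)"
    by (intro sum_mono) (simp add: factor)
  finally show ?thesis
    by (simp add: binomial_ratio_eq_prod[OF assms(1)])
qed

lemma ex_discrete_distribution:
  fixes w :: "nat \<Rightarrow> real" and pt :: "nat \<Rightarrow> real"
  assumes w: "\<And>k. k \<le> N \<Longrightarrow> 0 \<le> w k" and sum: "(\<Sum>k\<le>N. w k) = 1"
  shows "\<exists>M. real_distribution M \<and>
    (\<forall>f \<in> borel_measurable borel. (\<integral>x. f x \<partial>M) = (\<Sum>k\<le>N. w k * f (pt k)))"
proof -
  define g where "g k = (if k \<le> N then w k else 0)" for k
  define P where "P = embed_pmf g"
  have g: "0 \<le> g k" for k
    using w by (simp add: g_def)
  have "(\<integral>\<^sup>+k. ennreal (g k) \<partial>count_space UNIV) = (\<Sum>k\<le>N. ennreal (g k))"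
    by (rule nn_integral_count_space') (auto simp: g_def)
  also have "\<dots> = ennreal (\<Sum>k\<le>N. g k)"
    by (rule sum_ennreal) (simp add: g)
  also have "(\<Sum>k\<le>N. g k) = 1"
    using sum by (simp add: g_def)
  finally have P: "pmf P k = g k" for k
    unfolding P_def by (intro pmf_embed_pmf g) simp
  have "real_distribution (distr (measure_pmf P) borel pt)"
    by (rule prob_space.real_distribution_distr[OF prob_space_measure_pmf]) simp
  moreover have "(\<integral>x. f x \<partial>distr (measure_pmf P) borel pt) = (\<Sum>k\<le>N. w k * f (pt k))"
    if f: "f \<in> borel_measurable borel" for f :: "real \<Rightarrow> real"
  proof -
    have "(\<integral>x. f x \<partial>distr (measure_pmf P) borel pt) = (\<integral>k. f (pt k) \<partial>measure_pmf P)"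
      using f by (intro integral_distr) simp_all
    also have "\<dots> = (\<Sum>k\<le>N. f (pt k) * pmf P k)"
      by (rule integral_measure_pmf_real) (auto simp: set_pmf_eq P g_def split: if_splits)
    also have "\<dots> = (\<Sum>k\<le>N. w k * f (pt k))"
      by (intro sum.cong) (auto simp: P g_def)
    finally show ?thesis .
  qed
  ultimately show ?thesis by blast
qed

text \<open>
  Hausdorff's moment problem. The discrete measures with weights \<open>L (bernstein_poly N k)\<close> at \<open>k / N\<close>
  are tight because they all live on \<open>[0, 1]\<close>. Their factorial moments agree exactly with the values
  of \<open>L\<close>, so the \<open>m\<close>-th power moment is off by at most \<open>m\<^sup>2 / N\<close>, and every weak limit point solves
  the problem.
\<close>

theorem (in poly_functional) unit_interval_moment_problem:
  assumes one: "L 1 = 1"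
    and pos: "\<And>k i. 0 \<le> L (indet ^ k * (1 - indet) ^ i)"
  obtains M where "prob_space M" "sets M = sets (restrict_space borel {0..1})"
    "\<And>p. L p = (\<integral>x. poly p x \<partial>M)"
proof -
  define w where "w N k = L (bernstein_poly (Suc N) k)" for N k
  define pt where "pt N k = real k / real (Suc N)" for N k
  have w_nonneg: "0 \<le> w N k" for N k
    by (simp add: w_def bernstein_poly_def smult pos)
  have moment: "(\<Sum>k\<le>Suc N. w N k * (real (k choose m) / real (Suc N choose m))) = L (indet ^ m)"
    if "m \<le> Suc N" for N m
    unfolding bernstein_factorial_moment[OF that, symmetric] sum smult w_def
    by (simp only: mult.commute)
  have w_sum: "(\<Sum>k\<le>Suc N. w N k) = 1" for N
    using moment[of 0 N] by (simp add: one)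
  have "\<exists>M. real_distribution M \<and> (\<forall>f \<in> borel_measurable borel.
      (\<integral>x. f x \<partial>M) = (\<Sum>k\<le>Suc N. w N k * f (pt N k)))" for N
    by (intro ex_discrete_distribution w_nonneg w_sum)
  then obtain \<mu> where \<mu>: "\<And>N. real_distribution (\<mu> N)"
    and int_\<mu>: "\<And>N f. f \<in> borel_measurable borel \<Longrightarrow>
      (\<integral>x. f x \<partial>\<mu> N) = (\<Sum>k\<le>Suc N. w N k * f (pt N k))"
    by metis
  have pt: "0 \<le> pt N k" "pt N k \<le> 1" if "k \<le> Suc N" for N k
    using that by (simp_all add: pt_def)
  \<comment> \<open>Tightness is expressed by half-open intervals, hence the left endpoint below \<open>0\<close>.\<close>
  have "measure (\<mu> N) {-1<..1} = 1" for N
  proof -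
    interpret real_distribution "\<mu> N" by (rule \<mu>)
    have "measure (\<mu> N) {-1<..1} = (\<integral>x. indicator {-1<..1::real} x \<partial>\<mu> N)"
      by simp
    also have "\<dots> = (\<Sum>k\<le>Suc N. w N k * indicator {-1<..1} (pt N k))"
      by (rule int_\<mu>) simp
    also have "\<dots> = (\<Sum>k\<le>Suc N. w N k)"
    proof (intro sum.cong refl)
      fix k assume "k \<in> {..Suc N}"
      then show "w N k * indicator {-1<..1} (pt N k) = w N k"
        using pt[of k N] by simp
    qed
    finally show ?thesis by (simp only: w_sum)
  qed
  then have "tight \<mu>"
    unfolding tight_def using \<mu>
    by (intro conjI allI impI exI[of _ "-1"] exI[of _ 1]) auto
  then obtain r M where r: "strict_mono r" and M: "real_distribution M"
    and conv: "weak_conv_m (\<mu> \<circ> id \<circ> r) M"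
    using tight_imp_convergent_subsubsequence[of \<mu> id] by (auto simp: strict_mono_id)
  interpret M: real_distribution M by (rule M)

  \<comment> \<open>The limit lives on the whole line. Retracting the line onto \<open>[0, 1]\<close> fixes all points \<open>pt N k\<close>
    and makes powers bounded; pushing the limit forward under the retraction then gives a measure
    on \<open>[0, 1]\<close>.\<close>
  define clip where "clip t = max 0 (min 1 t)" for t :: real
  have clip: "0 \<le> clip t" "clip t \<le> 1" for t
    by (auto simp: clip_def)
  have clip_pt: "clip (pt N k) = pt N k" if "k \<le> Suc N" for N k
    using pt[OF that] by (simp add: clip_def)
  have clip_cont: "isCont (\<lambda>t. clip t ^ m) x" for m x
    unfolding clip_def by (intro continuous_intros)
  have clip_meas: "clip \<in> borel_measurable borel"
    unfolding clip_def by measurable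
  have clip_power: "(\<integral>t. clip t ^ m \<partial>M) = L (indet ^ m)" for m
  proof (rule LIMSEQ_unique)
    have "(\<lambda>n. \<integral>t. clip t ^ m \<partial>((\<mu> \<circ> id \<circ> r) n)) \<longlonglongrightarrow> (\<integral>t. clip t ^ m \<partial>M)"
      by (rule weak_conv_imp_integral_bdd_continuous_conv[where B = 1])
         (use \<mu> M conv clip_cont clip in \<open>auto simp: comp_def intro!: power_le_one\<close>)
    then show "(\<lambda>n. \<integral>t. clip t ^ m \<partial>\<mu> (r n)) \<longlonglongrightarrow> (\<integral>t. clip t ^ m \<partial>M)"
      by simp
  next
    have "norm ((\<integral>t. clip t ^ m \<partial>\<mu> N) - L (indet ^ m)) \<le> real m * real m / real (Suc N)"
      if N: "m \<le> N" for N
    proof -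
      let ?d = "\<lambda>k. pt N k ^ m - real (k choose m) / real (Suc N choose m)"
      have "(\<integral>t. clip t ^ m \<partial>\<mu> N) = (\<Sum>k\<le>Suc N. w N k * clip (pt N k) ^ m)"
        by (rule int_\<mu>) (use clip_meas in measurable)
      also have "\<dots> = (\<Sum>k\<le>Suc N. w N k * pt N k ^ m)"
        by (intro sum.cong refl) (simp add: clip_pt)
      finally have "(\<integral>t. clip t ^ m \<partial>\<mu> N) - L (indet ^ m) = (\<Sum>k\<le>Suc N. w N k * ?d k)"
        using moment[of m N] N by (simp only: right_diff_distrib sum_subtractf)
      also have "norm \<dots> \<le> (\<Sum>k\<le>Suc N. w N k * (real m * real m / real (Suc N)))"
      proof (rule sum_norm_le)
        fix k assume "k \<in> {..Suc N}"
        then have "\<bar>?d k\<bar> \<le> real m * real m / real (Suc N)"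
          using binomial_ratio_power_bound[of m "Suc N" k] N
          by (simp only: pt_def abs_minus_commute) simp
        then have "w N k * \<bar>?d k\<bar> \<le> w N k * (real m * real m / real (Suc N))"
          by (rule mult_left_mono) (rule w_nonneg)
        then show "norm (w N k * ?d k) \<le> w N k * (real m * real m / real (Suc N))"
          by (simp only: real_norm_def abs_mult abs_of_nonneg[OF w_nonneg])
      qed
      also have "\<dots> = real m * real m / real (Suc N)"
        by (simp only: sum_distrib_right[symmetric] w_sum mult_1)
      finally show ?thesis .
    qed
    then have "\<forall>\<^sub>F N in sequentially.
        norm ((\<integral>t. clip t ^ m \<partial>\<mu> N) - L (indet ^ m)) \<le> real m * real m / real (Suc N)"
      by (rule eventually_sequentiallyI)
    moreover have "(\<lambda>N. real m * real m / real (Suc N)) \<longlonglongrightarrow> 0"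
      using tendsto_mult_right_zero[OF LIMSEQ_inverse_real_of_nat, of "real m * real m"]
      by (simp add: divide_inverse)
    ultimately have "(\<lambda>N. (\<integral>t. clip t ^ m \<partial>\<mu> N) - L (indet ^ m)) \<longlonglongrightarrow> 0"
      by (rule Lim_null_comparison)
    then have "(\<lambda>N. \<integral>t. clip t ^ m \<partial>\<mu> N) \<longlonglongrightarrow> L (indet ^ m)"
      by (rule LIM_zero_cancel)
    from LIMSEQ_subseq_LIMSEQ[OF this r]
    show "(\<lambda>n. \<integral>t. clip t ^ m \<partial>\<mu> (r n)) \<longlonglongrightarrow> L (indet ^ m)"
      by (simp add: comp_def)
  qed

  define M' where "M' = distr M (restrict_space borel {0..1}) clip"
  have clip_meas': "clip \<in> M \<rightarrow>\<^sub>M restrict_space borel {0..1}"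
    using clip_meas clip by (intro measurable_restrict_space2) auto
  have "prob_space M'"
    unfolding M'_def by (rule M.prob_space_distr) (rule clip_meas')
  moreover have "sets M' = sets (restrict_space borel {0..1})"
    by (simp add: M'_def)
  moreover have "L p = (\<integral>x. poly p x \<partial>M')" for p
  proof -
    have "integrable M (\<lambda>t. clip t ^ i)" for i
      by (rule M.integrable_const_bound[where B = 1])
         (use clip clip_meas in \<open>auto intro!: power_le_one\<close>)
    then have "(\<integral>t. poly p (clip t) \<partial>M) = (\<Sum>i\<le>degree p. coeff p i * L (indet ^ i))"
      by (simp add: poly_altdef clip_power)
    moreover have "poly p \<in> borel_measurable (restrict_space borel {0..1})"
      by (intro measurable_restrict_space1 borel_measurable_continuous_onI continuous_on_poly continuous_on_id)
    then have "(\<integral>x. poly p x \<partial>M') = (\<integral>t. poly p (clip t) \<partial>M)"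
      unfolding M'_def by (intro integral_distr clip_meas')
    ultimately show ?thesis
      by (simp add: expand[of p])
  qed
  ultimately show ?thesis by (rule that)
qed

section \<open>The moment problem on the symmetric interval\<close>

text \<open>
  If the first step went up, convexity would force linear growth.
\<close>

lemma convex_bounded_sequence_decreasing:
  fixes s :: "nat \<Rightarrow> real"
  assumes convex: "\<And>k. 2 * s (Suc k) \<le> s k + s (Suc (Suc k))"
    and bounded: "\<And>k. s k \<le> B"
  shows "s 1 \<le> s 0"
proof (rule ccontr)
  assume "\<not> s 1 \<le> s 0"
  then have d: "0 < s 1 - s 0" by simp
  have slope: "s 1 - s 0 \<le> s (Suc k) - s k" for k
  proof (induction k)
    case (Suc k)
    then show ?case using convex[of k] by simp
  qed simp
  have "s 0 + real k * (s 1 - s 0) \<le> s k" for k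
  proof (induction k)
    case (Suc k)
    then show ?case using slope[of k] by (simp add: algebra_simps)
  qed simp
  moreover obtain k where "B - s 0 < real k * (s 1 - s 0)"
    using reals_Archimedean3[OF d] by blast
  ultimately show False
    using bounded[of k] by (smt (verit))
qed

text \<open>
  The bound on the moments is what confines the representing measure to \<open>[-1, 1]\<close>; nonnegativity on
  squares alone would only give a measure on the line.
\<close>

locale square_positive_functional = poly_functional +
  fixes C :: real
  assumes square: "0 \<le> L (q * q)"
    and bounded: "\<bar>L (indet ^ n)\<bar> \<le> C"
begin

text \<open>
  This is where boundedness of the moments enters. In the Hilbert space completion of the polynomials
  the statement says that multiplication by \<open>x\<^sup>2\<close> has quadratic form at most the identity; a vector
  on which it were larger would have orbits growing beyond every bound.
\<close>

lemma one_minus_square_nonneg: "0 \<le> L ((1 - indet * indet) * (q * q))"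
proof -
  define s where "s k = L ((q * q) * (indet ^ k * indet ^ k))" for k
  have "0 \<le> s k - 2 * s (Suc k) + s (Suc (Suc k))" for k
  proof -
    let ?r = "q * indet ^ k * (1 - indet * indet)"
    define u where "u = indet ^ k"
    define v where "v = (q * q) * (u * indet * (u * indet))"
    have "?r * ?r = (q * q) * (u * u) - (v + v) + (q * q) * (u * indet * indet * (u * indet * indet))"
      by (simp add: u_def[symmetric] v_def algebra_simps)
    then have "L (?r * ?r) = L ((q * q) * (u * u)) - (L v + L v)
        + L ((q * q) * (u * indet * indet * (u * indet * indet)))"
      by (simp only: add diff)
    also have "\<dots> = s k - 2 * s (Suc k) + s (Suc (Suc k))"
      by (simp add: s_def u_def v_def mult_ac)
    finally have "L (?r * ?r) = s k - 2 * s (Suc k) + s (Suc (Suc k))" .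
    then show ?thesis
      using square[of ?r] by simp
  qed
  then have "2 * s (Suc k) \<le> s k + s (Suc (Suc k))" for k
    by (smt (verit))
  moreover have "s k \<le> (\<Sum>i\<le>degree (q * q). \<bar>coeff (q * q) i\<bar> * C)" for k
  proof -
    have "s k = (\<Sum>i\<le>degree (q * q). coeff (q * q) i * L (indet ^ (k + k + i)))"
      unfolding s_def by (subst mult.commute, subst expand_mult) (simp add: power_add)
    also have "\<dots> \<le> (\<Sum>i\<le>degree (q * q). \<bar>coeff (q * q) i\<bar> * C)"
      by (rule sum_mono, rule order_trans[OF abs_ge_self]) (simp add: abs_mult mult_left_mono bounded)
    finally show ?thesis .
  qed
  ultimately have "s 1 \<le> s 0"
    by (rule convex_bounded_sequence_decreasing)
  moreover have "(1 - indet * indet) * (q * q) = (q * q) * (indet ^ 0 * indet ^ 0) - (q * q) * (indet ^ 1 * indet ^ 1)"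
    by (simp add: algebra_simps power2_eq_square)
  then have "L ((1 - indet * indet) * (q * q)) = s 0 - s 1"
    by (simp only: s_def diff)
  ultimately show ?thesis by simp
qed

text \<open>
  The weight \<open>1 - x\<close> is half of \<open>(1 - x)\<^sup>2 + (1 - x\<^sup>2)\<close>, which consists of a square and the weight
  treated before; likewise for \<open>1 + x\<close>.
\<close>

lemma one_minus_nonneg: "0 \<le> L ((1 - indet) * (q * q))"
proof -
  let ?r = "(1 - indet) * q"
  have "(1 - indet) * (q * q) + (1 - indet) * (q * q) = ?r * ?r + (1 - indet * indet) * (q * q)"
    by (simp add: algebra_simps)
  then have "L ((1 - indet) * (q * q)) + L ((1 - indet) * (q * q)) = L (?r * ?r) + L ((1 - indet * indet) * (q * q))"
    by (metis add)
  then show ?thesis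
    using square[of ?r] one_minus_square_nonneg[of q] by simp
qed

lemma one_plus_nonneg: "0 \<le> L ((1 + indet) * (q * q))"
proof -
  let ?r = "(1 + indet) * q"
  have "(1 + indet) * (q * q) + (1 + indet) * (q * q) = ?r * ?r + (1 - indet * indet) * (q * q)"
    by (simp add: algebra_simps)
  then have "L ((1 + indet) * (q * q)) + L ((1 + indet) * (q * q)) = L (?r * ?r) + L ((1 - indet * indet) * (q * q))"
    by (metis add)
  then show ?thesis
    using square[of ?r] one_minus_square_nonneg[of q] by simp
qed

text \<open>
  Splitting off the largest square leaves one of the weights \<open>1\<close>, \<open>1 - x\<close>, \<open>1 + x\<close>, \<open>1 - x\<^sup>2\<close>,
  according to the parities of the exponents.
\<close>

lemma endpoint_powers_nonneg: "0 \<le> L ((1 + indet) ^ k * (1 - indet) ^ i)"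
proof -
  define q where "q = (1 + indet) ^ (k div 2) * (1 - indet) ^ (i div 2)"
  have split: "u ^ n = u ^ (n mod 2) * (u ^ (n div 2) * u ^ (n div 2))" for u :: "real poly" and n
    by (metis mod_div_mult_eq mult.commute mult_2 power_add)
  have eq: "(1 + indet) ^ k * (1 - indet) ^ i
      = ((1 + indet) ^ (k mod 2) * (1 - indet) ^ (i mod 2)) * (q * q)"
    by (subst split[of _ k], subst split[of _ i]) (simp add: q_def mult_ac)
  have "(1 + indet) * (1 - indet) = 1 - indet * indet"
    by (simp add: algebra_simps)
  then show ?thesis
    unfolding eq using square[of q] one_minus_square_nonneg[of q] one_minus_nonneg[of q] one_plus_nonneg[of q]
    by (cases "even k"; cases "even i") (simp_all add: even_iff_mod_2_eq_zero odd_iff_mod_2_eq_one)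
qed

theorem symmetric_interval_moment_problem:
  assumes one: "L 1 = 1"
  obtains M where "prob_space M" "sets M = sets (restrict_space borel {-1..1})"
    "\<And>p. L p = (\<integral>x. poly p x \<partial>M)"
proof -
  define to_unit where "to_unit = smult (1 / 2) (1 + indet)"
  define from_unit where "from_unit = smult 2 indet - 1"
  have one_minus: "1 - to_unit = smult (1 / 2) (1 - indet)"
    by (simp add: to_unit_def indet_def one_pCons)
  interpret U: poly_functional "\<lambda>p. L (pcompose p to_unit)"
    by unfold_locales (simp_all add: pcompose_add pcompose_smult add smult)
  have "0 \<le> L (pcompose (indet ^ k * (1 - indet) ^ i) to_unit)" for k i
  proof -
    have "pcompose (indet ^ k * (1 - indet) ^ i) to_unit
        = smult ((1 / 2) ^ k * (1 / 2) ^ i) ((1 + indet) ^ k * (1 - indet) ^ i)"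
      by (simp add: pcompose_mult one_minus) (simp add: to_unit_def smult_power mult_ac)
    then show ?thesis
      by (simp only: smult) (simp add: endpoint_powers_nonneg)
  qed
  moreover have "L (pcompose 1 to_unit) = 1"
    by (simp add: one pcompose_1)
  ultimately obtain M where M: "prob_space M" "sets M = sets (restrict_space borel {0..1})"
    and int: "\<And>p. L (pcompose p to_unit) = (\<integral>x. poly p x \<partial>M)"
    using U.unit_interval_moment_problem by blast
  interpret M: prob_space M by (rule M)
  have space: "space M = {0..1}"
    using sets_eq_imp_space_eq[OF M(2)] by (simp add: space_restrict_space)
  have poly_meas: "poly p \<in> borel_measurable (restrict_space borel A)" for p :: "real poly" and A
    by (intro measurable_restrict_space1 borel_measurable_continuous_onI continuous_on_poly continuous_on_id)
  have "poly from_unit \<in> borel_measurable M"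
    using poly_meas measurable_cong_sets[OF M(2) refl] by blast
  then have meas: "poly from_unit \<in> M \<rightarrow>\<^sub>M restrict_space borel {-1..1}"
    by (intro measurable_restrict_space2) (auto simp: space from_unit_def)
  define M' where "M' = distr M (restrict_space borel {-1..1}) (poly from_unit)"
  have "prob_space M'"
    unfolding M'_def by (rule M.prob_space_distr) (rule meas)
  moreover have "sets M' = sets (restrict_space borel {-1..1})"
    by (simp add: M'_def)
  moreover have "L p = (\<integral>x. poly p x \<partial>M')" for p
  proof -
    have "pcompose from_unit to_unit = indet"
      by (simp add: from_unit_def to_unit_def indet_def one_pCons pcompose_pCons pcompose_diff pcompose_smult)
    then have "pcompose (pcompose p from_unit) to_unit = p"
      by (simp add: pcompose_assoc[symmetric]) (simp add: indet_def)
    then have "L p = (\<integral>x. poly p (poly from_unit x) \<partial>M)"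
      using int[of "pcompose p from_unit"] by (simp add: poly_pcompose)
    also have "\<dots> = (\<integral>x. poly p x \<partial>M')"
      unfolding M'_def by (intro integral_distr[symmetric] meas poly_meas)
    finally show ?thesis .
  qed
  ultimately show ?thesis by (rule that)
qed

end

section \<open>Bounded sequences with nonnegative Hankel forms\<close>

definition moment_functional :: "(nat \<Rightarrow> real) \<Rightarrow> real poly \<Rightarrow> real" where
  "moment_functional a p = (\<Sum>i\<le>degree p. coeff p i * a i)"

text \<open>
  A common upper summation bound makes the defining sum additive in \<open>p\<close>.
\<close>

lemma moment_functional_eq_sum:
  "degree p \<le> n \<Longrightarrow> moment_functional a p = (\<Sum>i\<le>n. coeff p i * a i)"
  unfolding moment_functional_def by (intro sum.mono_neutral_left) (auto simp: coeff_eq_0)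

lemma poly_functional_moment_functional: "poly_functional (moment_functional a)"
proof
  fix p q :: "real poly"
  let ?n = "max (degree p) (degree q)"
  show "moment_functional a (p + q) = moment_functional a p + moment_functional a q"
    by (simp add: moment_functional_eq_sum[of _ ?n] degree_add_le_max sum.distrib distrib_right)
next
  fix c and p :: "real poly"
  show "moment_functional a (smult c p) = c * moment_functional a p"
    by (simp add: moment_functional_eq_sum[of "smult c p" "degree p"] moment_functional_def
        sum_distrib_left mult.assoc)
qed

lemma moment_functional_indet_power: "moment_functional a (indet ^ n) = a n"
proof -
  have "indet ^ n = monom 1 n"
    by (simp add: indet_def monom_altdef)
  moreover have "(\<Sum>i\<le>n. (if n = i then 1 else 0) * a i) = (\<Sum>i\<le>n. if n = i then a i else 0)"
    by (intro sum.cong) auto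
  ultimately show ?thesis
    by (simp add: moment_functional_def degree_monom_eq)
qed

text \<open>
  The Hankel form at the coefficients of \<open>q\<close> is the value of the moment functional on \<open>q * q\<close>. The
  sequence is normalized to total mass \<open>1\<close> for the preceding theorem; total mass \<open>0\<close> is handled by
  the null measure, since then the bound forces the sequence to vanish.
\<close>

theorem bounded_hankel_moment_problem:
  fixes a :: "nat \<Rightarrow> real"
  assumes hankel: "\<And>n c. 0 \<le> (\<Sum>i\<le>n. \<Sum>j\<le>n. a (i + j) * c i * c j)"
    and bounded: "\<And>n. \<bar>a n\<bar> \<le> a 0"
  obtains \<mu> where "finite_measure \<mu>" "sets \<mu> = sets (restrict_space borel {-1..1})"
    "\<And>n. a n = (\<integral>x. x ^ n \<partial>\<mu>)"
proof (cases "a 0 = 0")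
  case True
  have "finite_measure (null_measure (restrict_space borel {-1..1::real}))"
    by (intro finite_measureI) simp
  moreover have "a n = (\<integral>x. x ^ n \<partial>null_measure (restrict_space borel {-1..1}))" for n
    using bounded[of n] True by simp
  ultimately show ?thesis
    by (intro that[of "null_measure (restrict_space borel {-1..1})"]) simp_all
next
  case False
  then have a0: "0 < a 0"
    using bounded[of 0] by simp
  define b where "b n = a n / a 0" for n
  interpret poly_functional "moment_functional b"
    by (rule poly_functional_moment_functional)
  interpret square_positive_functional "moment_functional b" 1
  proof
    fix q :: "real poly"
    have "moment_functional b (q * q) = (\<Sum>i\<le>degree q. coeff q i * moment_functional b (q * indet ^ i))"
      by (rule expand_mult)
    also have "\<dots> = (\<Sum>i\<le>degree q. coeff q i * (\<Sum>j\<le>degree q. coeff q j * b (i + j)))"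
    proof (intro sum.cong refl)
      fix i
      have "moment_functional b (q * indet ^ i) = (\<Sum>j\<le>degree q. coeff q j * b (i + j))"
        by (subst mult.commute, subst expand_mult)
           (simp add: moment_functional_indet_power flip: power_add)
      then show "coeff q i * moment_functional b (q * indet ^ i)
          = coeff q i * (\<Sum>j\<le>degree q. coeff q j * b (i + j))"
        by simp
    qed
    also have "\<dots> = (\<Sum>i\<le>degree q. \<Sum>j\<le>degree q. a (i + j) * coeff q i * coeff q j) / a 0"
      by (simp add: b_def sum_distrib_left sum_divide_distrib mult_ac)
    finally show "0 \<le> moment_functional b (q * q)"
      using hankel[where n = "degree q" and c = "coeff q"] a0 by simp
  next
    fix n
    show "\<bar>moment_functional b (indet ^ n)\<bar> \<le> 1"
      using bounded[of n] a0 by (simp add: moment_functional_indet_power b_def abs_divide)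
  qed
  have "moment_functional b 1 = 1"
    using moment_functional_indet_power[of b 0] a0 by (simp add: b_def)
  then obtain M where M: "prob_space M" "sets M = sets (restrict_space borel {-1..1})"
    and int: "\<And>p. moment_functional b p = (\<integral>x. poly p x \<partial>M)"
    using symmetric_interval_moment_problem by blast
  interpret M: prob_space M by (rule M)
  define \<mu> where "\<mu> = density M (\<lambda>_. ennreal (a 0))"
  have "finite_measure \<mu>"
    by (rule finite_measureI) (simp add: \<mu>_def emeasure_density M.emeasure_space_1 ennreal_mult_eq_top_iff)
  moreover have "sets \<mu> = sets (restrict_space borel {-1..1})"
    by (simp add: \<mu>_def M)
  moreover have "a n = (\<integral>x. x ^ n \<partial>\<mu>)" for n
  proof -
    have "(\<lambda>x. x ^ n) \<in> borel_measurable (restrict_space borel {-1..1::real})"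
      by (intro measurable_restrict_space1) simp
    then have "(\<lambda>x. x ^ n) \<in> borel_measurable M"
      using measurable_cong_sets[OF M(2) refl] by blast
    then have "(\<integral>x. x ^ n \<partial>\<mu>) = a 0 * (\<integral>x. x ^ n \<partial>M)"
      unfolding \<mu>_def using a0 by (subst integral_density) simp_all
    also have "(\<integral>x. x ^ n \<partial>M) = b n"
      using int[of "indet ^ n"] by (simp add: moment_functional_indet_power)
    finally show ?thesis
      using a0 by (simp add: b_def)
  qed
  ultimately show ?thesis by (rule that)
qed


section \<open>Reflection positive functions are moment sequences\<close>

text \<open>
  Comparing the points \<open>0\<close> and \<open>n\<close>, Hermitian symmetry of the second kernel reads \<open>\<phi> n = cnj (\<phi> n)\<close>
  for \<open>n \<ge> 0\<close>, and that of the first reads \<open>\<phi> (- n) = cnj (\<phi> n)\<close>.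
\<close>

lemma reflection_positive_int_real_even:
  assumes "reflection_positive_int \<phi>"
  shows "\<phi> n = complex_of_real (Re (\<phi> (int (nat \<bar>n\<bar>))))"
proof -
  have toeplitz: "pos_def_kernel_on UNIV (\<lambda>n m. \<phi> (n - m))"
    and hankel: "pos_def_kernel_on {0..} (\<lambda>n m. \<phi> (n + m))"
    using assms by (simp_all add: reflection_positive_int_def pos_def_fun_def)
  have real: "\<phi> k = cnj (\<phi> k)" if "0 \<le> k" for k
    using pos_def_kernel_on_hermitian[OF hankel, of 0 k] that by simp
  have "\<phi> (- k) = cnj (\<phi> k)" for k
    using pos_def_kernel_on_hermitian[OF toeplitz, of k 0] by simp
  from this[of "- n"] real[of "- n"] have "\<phi> n = \<phi> \<bar>n\<bar>"
    by (cases "0 \<le> n") simp_all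
  with real[of "\<bar>n\<bar>"] show ?thesis
    by (simp add: complex_eq_iff)
qed

text \<open>
  Testing the first kernel on the points \<open>0\<close> and \<open>n\<close> with the coefficients \<open>(1, 1)\<close> and \<open>(1, -1)\<close>
  gives \<open>\<phi> 0 + \<phi> n \<ge> 0\<close> and \<open>\<phi> 0 - \<phi> n \<ge> 0\<close>.
\<close>

lemma reflection_positive_int_bounded:
  assumes "reflection_positive_int \<phi>"
  shows "\<bar>Re (\<phi> (int n))\<bar> \<le> Re (\<phi> 0)"
proof -
  define a where "a n = Re (\<phi> (int n))" for n
  have \<phi>: "\<phi> k = complex_of_real (a (nat \<bar>k\<bar>))" for k
    unfolding a_def by (rule reflection_positive_int_real_even[OF assms])
  have toeplitz: "(\<Sum>x\<in>F. \<Sum>y\<in>F. \<phi> (x - y) * cnj (c x) * c y) \<in> \<real>\<^sub>\<ge>\<^sub>0" if "finite F" for F c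
    using assms that by (simp add: reflection_positive_int_def pos_def_fun_def pos_def_kernel_on_def)
  show ?thesis
  proof (cases "n = 0")
    case True
    with toeplitz[of "{0}" "\<lambda>_. 1"] show ?thesis
      by (simp add: complex_nonneg_Reals_iff)
  next
    case False
    have "0 \<le> a 0 + a n"
      using toeplitz[of "{0, int n}" "\<lambda>_. 1"] False by (simp add: \<phi> complex_nonneg_Reals_iff)
    moreover have "0 \<le> a 0 - a n"
      using toeplitz[of "{0, int n}" "\<lambda>x. if x = 0 then 1 else - 1"] False
      by (simp add: \<phi> complex_nonneg_Reals_iff)
    ultimately show ?thesis
      by (simp add: a_def abs_le_iff)
  qed
qed

lemma reflection_positive_int_hankel:
  assumes "reflection_positive_int \<phi>"
  shows "0 \<le> (\<Sum>i\<le>n. \<Sum>j\<le>n. Re (\<phi> (int (i + j))) * c i * c j)"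
proof -
  define d where "d x = complex_of_real (c (nat x))" for x
  have "pos_def_kernel_on {0..} (\<lambda>n m. \<phi> (n + m))"
    using assms by (simp add: reflection_positive_int_def)
  moreover have "finite (int ` {..n})" "int ` {..n} \<subseteq> {0..}"
    by auto
  ultimately have "(\<Sum>x\<in>int ` {..n}. \<Sum>y\<in>int ` {..n}. \<phi> (x + y) * cnj (d x) * d y) \<in> \<real>\<^sub>\<ge>\<^sub>0"
    unfolding pos_def_kernel_on_def by blast
  then have "0 \<le> Re (\<Sum>i\<le>n. \<Sum>j\<le>n. \<phi> (int i + int j) * cnj (d (int i)) * d (int j))"
    by (simp add: sum.reindex complex_nonneg_Reals_iff)
  then show ?thesis
    by (simp add: d_def)
qed

theorem theorem4p1:
  fixes \<phi> :: "int \<Rightarrow> complex"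
  shows "reflection_positive_int \<phi> \<longleftrightarrow>
    (\<exists>\<mu> :: real measure.
       finite_measure \<mu> \<and> sets \<mu> = sets (restrict_space borel {-1..1}) \<and>
       (\<forall>n. \<phi> n = (\<integral>x. complex_of_real (x ^ nat \<bar>n\<bar>) \<partial>\<mu>)))"
proof
  assume rp: "reflection_positive_int \<phi>"
  define a where "a n = Re (\<phi> (int n))" for n
  obtain \<mu> where \<mu>: "finite_measure \<mu>" "sets \<mu> = sets (restrict_space borel {-1..1})"
    and a: "\<And>n. a n = (\<integral>x. x ^ n \<partial>\<mu>)"
    using bounded_hankel_moment_problem[of a]
      reflection_positive_int_hankel[OF rp] reflection_positive_int_bounded[OF rp]
    unfolding a_def by auto
  have "\<phi> n = (\<integral>x. complex_of_real (x ^ nat \<bar>n\<bar>) \<partial>\<mu>)" for n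
    unfolding integral_complex_of_real a[symmetric] a_def
    by (rule reflection_positive_int_real_even[OF rp])
  with \<mu> show "\<exists>\<mu> :: real measure.
       finite_measure \<mu> \<and> sets \<mu> = sets (restrict_space borel {-1..1}) \<and>
       (\<forall>n. \<phi> n = (\<integral>x. complex_of_real (x ^ nat \<bar>n\<bar>) \<partial>\<mu>))"
    by blast
next
  assume "\<exists>\<mu> :: real measure.
       finite_measure \<mu> \<and> sets \<mu> = sets (restrict_space borel {-1..1}) \<and>
       (\<forall>n. \<phi> n = (\<integral>x. complex_of_real (x ^ nat \<bar>n\<bar>) \<partial>\<mu>))"
  then obtain \<mu> :: "real measure" where \<mu>: "finite_measure \<mu>"
      "sets \<mu> = sets (restrict_space borel {-1..1})"
    and \<phi>: "\<And>n. \<phi> n = (\<integral>x. complex_of_real (x ^ nat \<bar>n\<bar>) \<partial>\<mu>)"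
    by blast
  from \<phi> have "\<phi> = (\<lambda>n. \<integral>x. complex_of_real (x ^ nat \<bar>n\<bar>) \<partial>\<mu>)"
    by (rule ext)
  with reflection_positive_int_moments[OF \<mu>] show "reflection_positive_int \<phi>"
    by (simp only:)
qed

end
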